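(* Let $W=(w_{ij})_{n\times n}$ be a row-stochastic matrix, let $\beta\in(0,1)$ and let $\alpha\in(0,1)$. Suppose that for each $i\in\{1,\dots,n\}$ there exists at least one index $j\in\{1,\dots,n\}$ such that $w_{ij}>\frac12$. Consider the best-response opinion dynamics $$x(k+1)=\beta x(k)+(1-\beta)\operatorname{BR}^\alpha(x(k);W),\qquad k\in\mathbb{N},$$ which under these conditions can be rewritten as the linear system $x(k+1)=F\,x(k)$ with the row-stochastic matrix $F$ described in the context. Then the system $x(k+1)=F\,x(k)$ achieves consensus for any initial state $x(0)\in\mathbb{R}^n$ if and only if there exists only one strongly connected component with more than one node in the graph $\mathcal{G}(F)$, that is, there exists a unique (up to cyclic rotation) sequence of distinct nodes $i_1,i_2,\dots,i_l\in\{1,2,\dots,n\}$ such that $w_{i_ki_{k+1}}>\frac12$ for all $1\le k\le l-1$ and $w_{i_li_1}>\frac12$.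
   Context: A matrix is row-stochastic if all its entries are nonnegative and each row sums to $1$. $\mathbb{N}=\{0,1,2,\dots\}$. Social cost: for $x\in\mathbb{R}^n$, $z\in\mathbb{R}$ and $i\in\{1,\dots,n\}$, $u_i(z;x)=\sum_{j=1}^n w_{ij}|z-x_j|^\alpha$. Best-response operator: $\operatorname{BR}^\alpha(x;W)\in\mathbb{R}^n$ has $i$-th component $\operatorname{BR}^\alpha_i(x;W)$ determined by: (1) $\operatorname{BR}^\alpha_i(x;W)\in\arg\min_{z\in\mathbb{R}}u_i(z;x)$; (2) $|\operatorname{BR}^\alpha_i(x;W)-x_i|\le|z^*-x_i|$ for all $z^*\in\arg\min_{z\in\mathbb{R}}u_i(z;x)$; (3) if two distinct minimizers $z_1,z_2$ of $u_i(\cdot;x)$ both attain the minimal distance to $x_i$ among all minimizers, then $\operatorname{BR}^\alpha_i(x;W)=\min\{z_1,z_2\}$. The matrix $F$: under the stated conditions, for each $i$ the index $j$ with $w_{ij}>\frac12$ is unique; call it $j_i$. Then $\operatorname{BR}^\alpha_i(x;W)=x_{j_i}$ for every $x\in\mathbb{R}^n$, so the dynamics read $x(k+1)=F\,x(k)$ with $F=(f_{ij})_{n\times n}=\beta I+(1-\beta)P$, where $I$ is the identity matrix and $P$ is the matrix whose $i$-th row has a $1$ in position $j_i$ and zeros elsewhere. $\mathcal{G}(F)$ is the directed graph on the nodes $\{1,\dots,n\}$ with a link from $i$ to $j$ if and only if $f_{ij}>0$. A strongly connected component of a digraph is a strongly connected subgraph such that no other subgraph strictly containing it is strongly connected. The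 system achieves consensus from $x(0)$ if $x(k)$ converges, as $k\to\infty$, to a vector of the form $c\mathbf{1}_n$ with $c\in\mathbb{R}$, where $\mathbf{1}_n$ is the all-ones vector. Two sequences are the same up to cyclic rotation if one is a cyclic shift of the other.
   Formalization: The component criterion also counts a one-node component {i} with w_ii > 1/2 (a cycle with l = 1); "only one component with more than one node" is claimed literally only if no w_ii > 1/2, since it fails otherwise (n = 1, W = [1]). The unique-sequence criterion is stated in full. *)

theory Defs
  imports "HOL-Analysis.Analysis" "Graph_Theory.Digraph_Component"
begin

definition row_stochastic :: "real ^ 'n ^ 'n \<Rightarrow> bool" where
  "row_stochastic W \<longleftrightarrow> (\<forall>i j. 0 \<le> W $ i $ j) \<and> (\<forall>i. (\<Sum>j\<in>UNIV. W $ i $ j) = 1)"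

definition social_cost :: "real \<Rightarrow> real ^ 'n ^ 'n \<Rightarrow> real ^ 'n \<Rightarrow> 'n \<Rightarrow> real \<Rightarrow> real" where
  "social_cost \<alpha> W x i z = (\<Sum>j\<in>UNIV. W $ i $ j * \<bar>z - x $ j\<bar> powr \<alpha>)"

definition minimizers :: "real \<Rightarrow> real ^ 'n ^ 'n \<Rightarrow> real ^ 'n \<Rightarrow> 'n \<Rightarrow> real set" where
  "minimizers \<alpha> W x i = {z. is_arg_min (social_cost \<alpha> W x i) (\<lambda>_. True) z}"

definition nearest_minimizers :: "real \<Rightarrow> real ^ 'n ^ 'n \<Rightarrow> real ^ 'n \<Rightarrow> 'n \<Rightarrow> real set" where
  "nearest_minimizers \<alpha> W x i =
     {z \<in> minimizers \<alpha> W x i. \<forall>z' \<in> minimizers \<alpha> W x i. \<bar>z - x $ i\<bar> \<le> \<bar>z' - x $ i\<bar>}"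

definition best_response :: "real \<Rightarrow> real ^ 'n ^ 'n \<Rightarrow> real ^ 'n \<Rightarrow> real ^ 'n" where
  "best_response \<alpha> W x = (\<chi> i. THE b.
     b \<in> nearest_minimizers \<alpha> W x i \<and>
     (\<forall>z1 \<in> nearest_minimizers \<alpha> W x i. \<forall>z2 \<in> nearest_minimizers \<alpha> W x i.
        z1 \<noteq> z2 \<longrightarrow> b = min z1 z2))"

definition br_step :: "real \<Rightarrow> real \<Rightarrow> real ^ 'n ^ 'n \<Rightarrow> real ^ 'n \<Rightarrow> real ^ 'n" where
  "br_step \<alpha> \<beta> W x = \<beta> *\<^sub>R x + (1 - \<beta>) *\<^sub>R best_response \<alpha> W x"

text \<open>The index \<open>j\<^sub>i\<close>; meaningful only if row \<open>i\<close> has exactly one entry above one half.\<close>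

definition dominant :: "real ^ 'n ^ 'n \<Rightarrow> 'n \<Rightarrow> 'n" where
  "dominant W i = (THE j. W $ i $ j > 1 / 2)"

definition P_matrix :: "real ^ 'n ^ 'n \<Rightarrow> real ^ 'n ^ 'n" where
  "P_matrix W = (\<chi> i j. if j = dominant W i then 1 else 0)"

definition F_matrix :: "real \<Rightarrow> real ^ 'n ^ 'n \<Rightarrow> real ^ 'n ^ 'n" where
  "F_matrix \<beta> W = \<beta> *\<^sub>R mat 1 + (1 - \<beta>) *\<^sub>R P_matrix W"

definition matrix_digraph :: "real ^ 'n ^ 'n \<Rightarrow> ('n, 'n \<times> 'n) pre_digraph" where
  "matrix_digraph A =
     \<lparr> verts = UNIV, arcs = {(i, j). A $ i $ j > 0}, tail = fst, head = snd \<rparr>"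

text \<open>\<open>f\<close> is the one-step map, so the state at time \<open>k\<close> is \<open>(f ^^ k) x0\<close>.\<close>

definition achieves_consensus :: "(real ^ 'n \<Rightarrow> real ^ 'n) \<Rightarrow> real ^ 'n \<Rightarrow> bool" where
  "achieves_consensus f x0 \<longleftrightarrow> (\<exists>c. (\<lambda>k. (f ^^ k) x0) \<longlonglongrightarrow> (\<chi> i. c))"

text \<open>Length one is allowed: \<open>[i]\<close> is such a cycle iff \<open>W $ i $ i > 1 / 2\<close>.\<close>

definition majority_cycle :: "real ^ 'n ^ 'n \<Rightarrow> 'n list \<Rightarrow> bool" where
  "majority_cycle W p \<longleftrightarrow> p \<noteq> [] \<and> distinct p \<and>
     (\<forall>k. Suc k < length p \<longrightarrow> W $ (p ! k) $ (p ! Suc k) > 1 / 2) \<and>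
     W $ last p $ hd p > 1 / 2"

definition unique_majority_cycle :: "real ^ 'n ^ 'n \<Rightarrow> bool" where
  "unique_majority_cycle W \<longleftrightarrow>
     (\<exists>p. majority_cycle W p \<and> (\<forall>q. majority_cycle W q \<longrightarrow> (\<exists>m. q = rotate m p)))"

text \<open>A node \<open>i\<close> with \<open>W $ i $ i > 1 / 2\<close> is a majority cycle of length one, but its strongly
  connected component in the digraph of \<open>F_matrix \<beta> W\<close> is the single node \<open>i\<close>. All nodes of
  that digraph carry loops because \<open>\<beta> > 0\<close>, so the digraph alone does not single out such an
  \<open>i\<close> by a loop. To match the majority cycles, the components that are counted have
  to include these singletons besides the components with more than one node. With one node
  and \<open>W = mat 1\<close>, for instance, consensus is trivial although no component has more
  than one node.\<close>

definition cyclic_component :: "real ^ 'n ^ 'n \<Rightarrow> ('n, 'n \<times> 'n) pre_digraph \<Rightarrow> bool" where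
  "cyclic_component W C \<longleftrightarrow>
     card (verts C) > 1 \<or> (\<exists>i. verts C = {i} \<and> W $ i $ i > 1 / 2)"

end

theory Submission
  imports Defs "HOL-Combinatorics.Orbits"
begin

text \<open>
  Put \<open>f = dominant W\<close>. Since \<open>t \<mapsto> t powr \<alpha>\<close> is subadditive on the nonnegative reals, moving away
  from \<open>x $ f i\<close> costs agent \<open>i\<close> more on the entry of weight above \<open>1/2\<close> than it can save on all other
  entries together (\<open>social_cost_gap\<close>). Hence \<open>x $ f i\<close> is the only best response, and the dynamics
  are the lazy walk \<open>x $ i \<leftarrow> \<beta> * x $ i + (1 - \<beta>) * x $ f i\<close> along the functional graph of \<open>f\<close>.

  Every path in the graph of a self-map of a finite set ends in a cycle, so everything is decided by
  the number of cycles: each of the three properties in the theorem is shown to be equivalent to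
  \<open>\<exists>!S. cyclic_on f S\<close>.

  For consensus (\<open>consensus_iff_unique_cycle\<close>): opinions that are constant on each of two different
  cycles never change there, so two cycles allow a persistent disagreement. If there is a single
  cycle, all agents reach one common agent \<open>a\<close> within \<open>N\<close> steps. Because of the laziness there is
  no periodicity to worry about: after exactly \<open>N\<close> steps every agent gives \<open>a\<close> a weight of at least
  \<open>min \<beta> (1 - \<beta>) ^ N\<close>, and the spread of the opinions shrinks by a fixed factor.

  For the components (\<open>unique_cyclic_scc_iff\<close>): reachability in the digraph of \<open>F_matrix \<beta> W\<close> is
  iteration of \<open>f\<close>, so the strongly connected component of a periodic point is its orbit, while the
  component of any other point is a singleton which \<open>f\<close> leaves.

  For the majority cycles (\<open>unique_cycle_list_iff\<close>): they are the enumerations of the cycles of \<open>f\<close>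
  in the order of \<open>f\<close>, and two enumerations of the same cycle differ by a rotation.
\<close>

section \<open>Best responses to a strict majority\<close>

text \<open>After division by \<open>a + b\<close> this says that \<open>t \<le> t powr p\<close> for the two fractions
  \<open>t \<in> [0, 1]\<close> that add up to \<open>1\<close>.\<close>

lemma powr_add_le_add_powr:
  fixes a b p :: real
  assumes "0 \<le> a" "0 \<le> b" "0 \<le> p" "p \<le> 1"
  shows "(a + b) powr p \<le> a powr p + b powr p"
proof (cases "a + b = 0")
  case True
  then show ?thesis using assms by simp
next
  case False
  then have s: "0 < a + b" using assms by linarith
  have "1 = a / (a + b) + b / (a + b)" using s by (simp add: add_divide_distrib[symmetric])
  also have "\<dots> \<le> (a / (a + b)) powr p + (b / (a + b)) powr p"
    using powr_mono'[of p 1 "a / (a + b)"] powr_mono'[of p 1 "b / (a + b)"] assms s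
    by (intro add_mono) simp_all
  also have "\<dots> = (a powr p + b powr p) / (a + b) powr p"
    using assms s by (simp add: powr_divide add_divide_distrib)
  finally show ?thesis using s by (simp add: field_simps)
qed

text \<open>The triangle inequality survives the passage to the power \<open>\<alpha>\<close>. Leaving \<open>x $ j\<close> by a distance
  \<open>d\<close> therefore saves at most \<open>d powr \<alpha>\<close> on each other entry, and these have total weight
  \<open>1 - W $ i $ j\<close>.\<close>

lemma social_cost_gap:
  fixes W :: "real ^ 'n ^ 'n" and x :: "real ^ 'n"
  assumes W: "row_stochastic W" and \<alpha>: "0 \<le> \<alpha>" "\<alpha> \<le> 1"
  shows "social_cost \<alpha> W x i (x $ j) + (2 * W $ i $ j - 1) * \<bar>z - x $ j\<bar> powr \<alpha>
    \<le> social_cost \<alpha> W x i z"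
proof -
  let ?d = "\<bar>z - x $ j\<bar> powr \<alpha>" and ?R = "UNIV - {j}"
  have nonneg: "0 \<le> W $ i $ l" for l using W by (simp add: row_stochastic_def)
  have rest: "(\<Sum>l\<in>?R. W $ i $ l) = 1 - W $ i $ j"
    using W sum.remove[of UNIV j "\<lambda>l. W $ i $ l"] by (simp add: row_stochastic_def)
  have split: "social_cost \<alpha> W x i y = W $ i $ j * \<bar>y - x $ j\<bar> powr \<alpha>
      + (\<Sum>l\<in>?R. W $ i $ l * \<bar>y - x $ l\<bar> powr \<alpha>)" for y
    unfolding social_cost_def by (rule sum.remove) simp_all
  have tri: "\<bar>x $ j - x $ l\<bar> powr \<alpha> \<le> \<bar>z - x $ l\<bar> powr \<alpha> + ?d" for l
  proof -
    have "\<bar>x $ j - x $ l\<bar> powr \<alpha> \<le> (\<bar>z - x $ l\<bar> + \<bar>z - x $ j\<bar>) powr \<alpha>"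
      using \<alpha> by (intro powr_mono2) auto
    also have "\<dots> \<le> \<bar>z - x $ l\<bar> powr \<alpha> + ?d"
      using \<alpha> by (intro powr_add_le_add_powr) auto
    finally show ?thesis .
  qed
  have "(\<Sum>l\<in>?R. W $ i $ l * \<bar>x $ j - x $ l\<bar> powr \<alpha>)
      \<le> (\<Sum>l\<in>?R. W $ i $ l * (\<bar>z - x $ l\<bar> powr \<alpha> + ?d))"
    by (intro sum_mono mult_left_mono tri nonneg)
  also have "\<dots> = (\<Sum>l\<in>?R. W $ i $ l * \<bar>z - x $ l\<bar> powr \<alpha>) + (1 - W $ i $ j) * ?d"
    by (simp add: distrib_left sum.distrib sum_distrib_right[symmetric] rest)
  finally show ?thesis by (simp add: split algebra_simps)
qed

lemma best_response_majority:
  fixes W :: "real ^ 'n ^ 'n"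
  assumes W: "row_stochastic W" and \<alpha>: "0 < \<alpha>" "\<alpha> \<le> 1" and j: "W $ i $ j > 1 / 2"
  shows "best_response \<alpha> W x $ i = x $ j"
proof -
  have less: "social_cost \<alpha> W x i (x $ j) < social_cost \<alpha> W x i z" if "z \<noteq> x $ j" for z
  proof -
    have "0 < (2 * W $ i $ j - 1) * \<bar>z - x $ j\<bar> powr \<alpha>" using j that by simp
    then show ?thesis using social_cost_gap[OF W, of \<alpha> x i j z] \<alpha> by linarith
  qed
  have min: "minimizers \<alpha> W x i = {x $ j}"
    using less by (auto simp: minimizers_def is_arg_min_def) (metis less_asym)
  have "nearest_minimizers \<alpha> W x i = {x $ j}"
    by (auto simp: nearest_minimizers_def min)
  then show ?thesis by (simp add: best_response_def)
qed

text \<open>Two entries above \<open>1/2\<close> in one row would sum to more than \<open>1\<close>, so the description in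
  \<open>dominant\<close> is proper.\<close>

lemma majority_iff_dominant:
  fixes W :: "real ^ 'n ^ 'n"
  assumes W: "row_stochastic W" and ex: "\<exists>j. W $ i $ j > 1 / 2"
  shows "W $ i $ j > 1 / 2 \<longleftrightarrow> j = dominant W i"
proof -
  have unique: "j = k" if "W $ i $ j > 1 / 2" "W $ i $ k > 1 / 2" for j k
  proof (rule ccontr)
    assume "j \<noteq> k"
    then have "W $ i $ j + W $ i $ k = (\<Sum>l\<in>{j, k}. W $ i $ l)" by simp
    also have "\<dots> \<le> (\<Sum>l\<in>UNIV. W $ i $ l)"
      using W by (intro sum_mono2) (auto simp: row_stochastic_def)
    also have "\<dots> = 1" using W by (simp add: row_stochastic_def)
    finally show False using that by linarith
  qed
  then have "\<exists>!j. W $ i $ j > 1 / 2" using ex by blast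
  from theI'[OF this] show ?thesis unfolding dominant_def using unique by blast
qed

section \<open>The lazy walk along a self-map\<close>

definition lazy_step :: "real \<Rightarrow> ('n \<Rightarrow> 'n) \<Rightarrow> real ^ 'n \<Rightarrow> real ^ 'n" where
  "lazy_step \<beta> f x = (\<chi> i. \<beta> * x $ i + (1 - \<beta>) * x $ f i)"

lemma F_matrix_nth:
  "F_matrix \<beta> W $ i $ j
    = (if j = i then \<beta> else 0) + (if j = dominant W i then 1 - \<beta> else 0)"
  by (simp add: F_matrix_def P_matrix_def mat_def)

lemma F_matrix_mult: "F_matrix \<beta> W *v x = lazy_step \<beta> (dominant W) x"
  by (simp add: lazy_step_def matrix_vector_mult_def vec_eq_iff F_matrix_nth
      distrib_right sum.distrib mult_delta_left)

lemma row_stochastic_F_matrix: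
  assumes "0 \<le> \<beta>" "\<beta> \<le> 1"
  shows "row_stochastic (F_matrix \<beta> W)"
  using assms by (simp add: row_stochastic_def F_matrix_nth sum.distrib)

lemma lazy_step_funpow_affine:
  "(lazy_step \<beta> f ^^ k) (\<chi> i. c * x $ i + d) = (\<chi> i. c * (lazy_step \<beta> f ^^ k) x $ i + d)"
  by (induction k) (simp_all add: lazy_step_def vec_eq_iff algebra_simps)

text \<open>A walk of length \<open>k\<close> that waits during its last \<open>k - m\<close> steps leads from \<open>i\<close> to
  \<open>(f ^^ m) i\<close>, and every step or wait has probability at least \<open>min \<beta> (1 - \<beta>)\<close>. Allowing every
  \<open>m \<le> k\<close> is what makes one \<open>k\<close> serve for agents at different distances from the cycle.\<close>

lemma lazy_step_funpow_ge:
  fixes y :: "real ^ 'n"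
  assumes \<beta>: "0 \<le> \<beta>" "\<beta> \<le> 1" and nonneg: "\<And>i. 0 \<le> y $ i" and "m \<le> k"
  shows "min \<beta> (1 - \<beta>) ^ k * y $ ((f ^^ m) i) \<le> (lazy_step \<beta> f ^^ k) y $ i"
  using \<open>m \<le> k\<close>
proof (induction k arbitrary: m i)
  case 0
  then show ?case by simp
next
  case (Suc k)
  let ?g = "min \<beta> (1 - \<beta>)" and ?z = "(lazy_step \<beta> f ^^ k) y"
  have g: "0 \<le> ?g" "?g \<le> \<beta>" "?g \<le> 1 - \<beta>" using \<beta> by auto
  have z: "0 \<le> ?z $ j" for j
    using Suc.IH[of 0 j] mult_nonneg_nonneg[OF zero_le_power[OF g(1), of k] nonneg[of j]]
    by simp
  have step: "(lazy_step \<beta> f ^^ Suc k) y $ i = \<beta> * ?z $ i + (1 - \<beta>) * ?z $ f i"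
    by (simp add: lazy_step_def)
  have weak: "?g * ?z $ i \<le> (lazy_step \<beta> f ^^ Suc k) y $ i"
    "?g * ?z $ f i \<le> (lazy_step \<beta> f ^^ Suc k) y $ i"
    unfolding step using mult_right_mono[OF g(2) z[of i]] mult_right_mono[OF g(3) z[of "f i"]]
      mult_nonneg_nonneg[OF \<beta>(1) z[of i]] mult_nonneg_nonneg[of "1 - \<beta>", OF _ z[of "f i"]] \<beta>
    by linarith+
  show ?case
  proof (cases "m \<le> k")
    case True
    from mult_left_mono[OF Suc.IH[OF this, of i] g(1)] weak(1) show ?thesis by simp
  next
    case False
    with Suc.prems have m: "m = Suc k" by simp
    from mult_left_mono[OF Suc.IH[OF order_refl, of "f i"] g(1)] weak(2)
    show ?thesis unfolding m by (simp add: funpow_swap1)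
  qed
qed

text \<open>The previous bound, applied to the nonnegative vectors \<open>x - l\<close> and \<open>u - x\<close>.\<close>

lemma lazy_step_funpow_between:
  fixes x :: "real ^ 'n" and f :: "'n \<Rightarrow> 'n" and i :: 'n
  assumes \<beta>: "0 \<le> \<beta>" "\<beta> \<le> 1" and bounds: "\<And>i. x $ i \<in> {l..u}" and "m \<le> k"
  defines "\<delta> \<equiv> min \<beta> (1 - \<beta>) ^ k" and "a \<equiv> (f ^^ m) i"
  shows "(lazy_step \<beta> f ^^ k) x $ i \<in> {l + \<delta> * (x $ a - l)..u - \<delta> * (u - x $ a)}"
  using lazy_step_funpow_ge[OF \<beta>, of "\<chi> i. 1 * x $ i + - l" m k f i]
    lazy_step_funpow_ge[OF \<beta>, of "\<chi> i. - 1 * x $ i + u" m k f i] bounds \<open>m \<le> k\<close>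
  unfolding lazy_step_funpow_affine \<delta>_def a_def by simp

text \<open>The minimal opinion increases, the maximal one decreases, and over \<open>N\<close> steps their difference
  shrinks by the factor \<open>1 - \<delta>\<close>: all opinions are pulled towards the one that \<open>a\<close> held. Both
  sequences converge by monotonicity, and the contraction forces their limits to agree.\<close>

lemma lazy_step_funpow_converges:
  fixes f :: "'n::finite \<Rightarrow> 'n"
  assumes \<beta>: "0 < \<beta>" "\<beta> < 1" and reach: "\<And>i. \<exists>m\<le>N. (f ^^ m) i = a"
  shows "achieves_consensus (lazy_step \<beta> f) x0"
proof -
  define \<delta> where "\<delta> = min \<beta> (1 - \<beta>) ^ N"
  have \<delta>: "0 < \<delta>" using \<beta> by (simp add: \<delta>_def)
  let ?x = "\<lambda>k. (lazy_step \<beta> f ^^ k) x0"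
  define l where "l k = Min (range (\<lambda>i. ?x k $ i))" for k
  define u where "u k = Max (range (\<lambda>i. ?x k $ i))" for k
  have lu: "?x k $ i \<in> {l k..u k}" for k i by (simp add: l_def u_def)
  have l_in: "l k \<in> range (\<lambda>i. ?x k $ i)" for k unfolding l_def by (intro Min_in) auto
  have u_in: "u k \<in> range (\<lambda>i. ?x k $ i)" for k unfolding u_def by (intro Max_in) auto
  have one: "?x (Suc k) $ i \<in> {l k..u k}" for k i
  proof -
    have "\<beta> * l k + (1 - \<beta>) * l k \<le> \<beta> * ?x k $ i + (1 - \<beta>) * ?x k $ f i"
      "\<beta> * ?x k $ i + (1 - \<beta>) * ?x k $ f i \<le> \<beta> * u k + (1 - \<beta>) * u k"
      using \<beta> lu[of k] by (intro add_mono mult_left_mono; simp)+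
    then show ?thesis by (simp add: lazy_step_def algebra_simps)
  qed
  have inc: "incseq l" using one l_in by (intro incseq_SucI) (metis atLeastAtMost_iff imageE)
  have dec: "decseq u" using one u_in by (intro decseq_SucI) (metis atLeastAtMost_iff imageE)
  have le: "l k \<le> u k" for k using lu[of k undefined] by simp
  have bl: "l k \<le> u 0" and bu: "l 0 \<le> u k" for k
    using le[of k] decseqD[OF dec, of 0 k] incseqD[OF inc, of 0 k] by linarith+
  obtain c where c: "l \<longlonglongrightarrow> c" using incseq_convergent[OF inc, of "u 0"] bl by blast
  obtain d where d: "u \<longlonglongrightarrow> d" using decseq_convergent[OF dec, of "l 0"] bu by blast
  have contract: "u (k + N) - l (k + N) \<le> (1 - \<delta>) * (u k - l k)" for k
  proof -
    let ?a = "?x k $ a"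
    have "?x (k + N) $ i \<in> {l k + \<delta> * (?a - l k)..u k - \<delta> * (u k - ?a)}" for i
    proof -
      obtain m where "m \<le> N" "(f ^^ m) i = a" using reach by blast
      moreover have "?x (k + N) = (lazy_step \<beta> f ^^ N) (?x k)"
        by (simp add: funpow_add add.commute[of k])
      ultimately show ?thesis
        using lazy_step_funpow_between[of \<beta> "?x k" "l k" "u k" m N f i] lu[of k] \<beta>
        by (auto simp: \<delta>_def)
    qed
    then have "l k + \<delta> * (?a - l k) \<le> l (k + N)" "u (k + N) \<le> u k - \<delta> * (u k - ?a)"
      using l_in[of "k + N"] u_in[of "k + N"] by fastforce+
    then show ?thesis by (simp add: algebra_simps)
  qed
  have "(\<lambda>k. u (k + N) - l (k + N)) \<longlonglongrightarrow> d - c"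
    using LIMSEQ_ignore_initial_segment[OF tendsto_diff[OF d c], of N] .
  moreover have "(\<lambda>k. (1 - \<delta>) * (u k - l k)) \<longlonglongrightarrow> (1 - \<delta>) * (d - c)"
    by (intro tendsto_intros c d)
  ultimately have "d - c \<le> (1 - \<delta>) * (d - c)"
    using contract by (intro LIMSEQ_le) auto
  then have "\<delta> * (d - c) \<le> 0" by (simp add: algebra_simps)
  then have "d \<le> c" using \<delta> by (simp add: mult_le_0_iff)
  moreover have "c \<le> d" using c d le by (intro LIMSEQ_le) auto
  ultimately have "d = c" by simp
  have "(\<lambda>k. ?x k $ i) \<longlonglongrightarrow> c" for i
  proof (rule tendsto_sandwich[OF _ _ c])
    show "u \<longlonglongrightarrow> c" using d \<open>d = c\<close> by simp
  qed (use lu in simp_all)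
  then show ?thesis unfolding achieves_consensus_def
    by (intro exI[of _ c] vec_tendstoI) simp
qed

text \<open>The indicator of \<open>A\<close> stays \<open>1\<close> on \<open>A\<close>, because \<open>f\<close> maps \<open>A\<close> to itself, and stays \<open>0\<close> on a
  disjoint invariant set.\<close>

lemma invariant_sets_meet_if_consensus:
  fixes f :: "'n::finite \<Rightarrow> 'n"
  assumes con: "achieves_consensus (lazy_step \<beta> f) (\<chi> i. if i \<in> A then 1 else 0)"
    and A: "f ` A \<subseteq> A" "A \<noteq> {}" and B: "f ` B \<subseteq> B" "B \<noteq> {}"
  shows "A \<inter> B \<noteq> {}"
proof
  assume disj: "A \<inter> B = {}"
  let ?x = "\<lambda>k. (lazy_step \<beta> f ^^ k) (\<chi> i. if i \<in> A then 1 else 0)"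
  have inv: "(\<forall>i\<in>A. ?x k $ i = 1) \<and> (\<forall>i\<in>B. ?x k $ i = 0)" for k
  proof (induction k)
    case 0
    then show ?case using disj by auto
  next
    case (Suc k)
    then show ?case using A(1) B(1) by (auto simp: lazy_step_def image_subset_iff)
  qed
  from con obtain c where c: "?x \<longlonglongrightarrow> (\<chi> i. c)" by (auto simp: achieves_consensus_def)
  have lim: "(\<lambda>k. ?x k $ i) \<longlonglongrightarrow> c" for i using tendsto_vec_nth[OF c, of i] by simp
  obtain a b where ab: "a \<in> A" "b \<in> B" using A(2) B(2) by blast
  have "c = 1" using lim[of a] ab inv by (simp add: LIMSEQ_const_iff)
  moreover have "c = 0" using lim[of b] ab inv by (simp add: LIMSEQ_const_iff)
  ultimately show False by simp
qed

section \<open>Consensus and cycles\<close>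

lemma ex_funpow_in_cycle:
  fixes f :: "'n::finite \<Rightarrow> 'n"
  obtains m S where "cyclic_on f S" "(f ^^ m) x \<in> S"
proof -
  have "\<not> inj (\<lambda>n. (f ^^ n) x)"
    using finite_imageD[of "\<lambda>n. (f ^^ n) x" UNIV] infinite_UNIV_nat by auto
  then obtain m n where "(f ^^ m) x = (f ^^ n) x" "m < n"
    unfolding inj_def by (metis nat_neq_iff)
  then have "(f ^^ m) x = (f ^^ (n - m)) ((f ^^ m) x)"
    by (metis funpow_add le_add_diff_inverse2 less_imp_le o_apply)
  then have "(f ^^ m) x \<in> orbit f ((f ^^ m) x)"
    using \<open>m < n\<close> by (metis (mono_tags, lifting) mem_Collect_eq orbit_altdef zero_less_diff)
  then show thesis using that by (meson cyclic_on_def)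
qed

lemma cyclic_on_disjoint:
  assumes "cyclic_on f S" "cyclic_on f T" "S \<inter> T \<noteq> {}"
  shows "S = T"
  using assms by (metis disjoint_iff orbit_cyclic_eq3)

lemma consensus_iff_unique_cycle:
  fixes f :: "'n::finite \<Rightarrow> 'n"
  assumes \<beta>: "0 < \<beta>" "\<beta> < 1"
  shows "(\<forall>x0. achieves_consensus (lazy_step \<beta> f) x0) \<longleftrightarrow> (\<exists>!S. cyclic_on f S)"
proof
  assume con: "\<forall>x0. achieves_consensus (lazy_step \<beta> f) x0"
  obtain S m where S: "cyclic_on f S" "(f ^^ m) undefined \<in> S" by (rule ex_funpow_in_cycle)
  show "\<exists>!S. cyclic_on f S"
  proof (rule ex1I[of _ S])
    fix T
    assume T: "cyclic_on f T"
    have closed: "f ` A \<subseteq> A \<and> A \<noteq> {}" if "cyclic_on f A" for A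
      using that cyclic_on_inI[OF that] by (auto simp: cyclic_on_alldef)
    show "T = S"
      using invariant_sets_meet_if_consensus[of \<beta> f T S] con closed[OF T] closed[OF S(1)]
        cyclic_on_disjoint[OF T S(1)] by blast
  qed (rule S(1))
next
  assume "\<exists>!S. cyclic_on f S"
  then obtain S where S: "cyclic_on f S" and unique: "\<And>T. cyclic_on f T \<Longrightarrow> T = S" by blast
  from S obtain a where a: "a \<in> S" by (auto simp: cyclic_on_def)
  have "\<exists>m. (f ^^ m) i = a" for i
  proof -
    obtain T m where T: "cyclic_on f T" "(f ^^ m) i \<in> T" by (rule ex_funpow_in_cycle)
    then have "a \<in> orbit f ((f ^^ m) i)" using unique a S by (simp add: orbit_cyclic_eq3)
    then obtain n where "(f ^^ n) ((f ^^ m) i) = a" by (auto simp: orbit_altdef)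
    then have "(f ^^ (n + m)) i = a" by (simp add: funpow_add)
    then show ?thesis ..
  qed
  then obtain t where t: "\<And>i. (f ^^ t i) i = a" by metis
  have "\<exists>m\<le>Max (range t). (f ^^ m) i = a" for i using t by (intro exI[of _ "t i"]) simp
  then show "\<forall>x0. achieves_consensus (lazy_step \<beta> f) x0"
    using lazy_step_funpow_converges[OF \<beta>] by blast
qed

section \<open>Strongly connected components of a functional digraph\<close>

text \<open>Every node carries a loop here, as in the digraph of \<open>F_matrix \<beta> W\<close>. The loops do not change
  reachability, but they hide the fixed points of \<open>f\<close>, which is why fixed points have to be listed
  separately when cycles are read off from components.\<close>

locale functional_digraph = wf_digraph G for G :: "('v, 'e) pre_digraph" (structure) +
  fixes f :: "'v \<Rightarrow> 'v"
  assumes verts_UNIV: "verts G = UNIV"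
    and adj_iff: "\<And>u v. u \<rightarrow> v \<longleftrightarrow> v = u \<or> v = f u"
begin

lemma reachable_iff_funpow: "u \<rightarrow>\<^sup>* v \<longleftrightarrow> (\<exists>n. (f ^^ n) u = v)"
proof
  assume "u \<rightarrow>\<^sup>* v"
  then show "\<exists>n. (f ^^ n) u = v"
  proof (induction rule: reachable_induct)
    case base
    then show ?case by (intro exI[of _ 0]) simp
  next
    case (step v w)
    then obtain n where n: "(f ^^ n) u = v" by blast
    from step have "w = v \<or> w = f v" by (simp add: adj_iff)
    then show ?case using n by (auto intro: exI[of _ n] exI[of _ "Suc n"])
  qed
next
  assume "\<exists>n. (f ^^ n) u = v"
  then obtain n where "v = (f ^^ n) u" by blast
  moreover have "u \<rightarrow>\<^sup>* (f ^^ n) u" for n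
  proof (induction n)
    case 0
    then show ?case by (simp add: verts_UNIV)
  next
    case (Suc n)
    moreover have "(f ^^ n) u \<rightarrow> (f ^^ Suc n) u" by (simp add: adj_iff)
    ultimately show ?case by (rule reachable_adj_trans)
  qed
  ultimately show "u \<rightarrow>\<^sup>* v" by simp
qed

lemma reachable_iff_orbit: "u \<rightarrow>\<^sup>* v \<longleftrightarrow> v = u \<or> v \<in> orbit f u"
  unfolding reachable_iff_funpow orbit_altdef by (auto intro: exI[of _ 0]) (metis funpow_0 gr0I)

lemma scc_of_periodic:
  assumes "u \<in> orbit f u"
  shows "scc_of u = orbit f u"
  using assms orbit_swap[OF assms] unfolding scc_of_def reachable_iff_orbit by auto

text \<open>Two different nodes of one component reach each other, so both lie on a cycle of \<open>f\<close>, and the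
  component is that cycle.\<close>

lemma cyclic_scc_iff:
  "S \<in> sccs_verts \<and> (card S > 1 \<or> (\<exists>u. S = {u} \<and> f u = u)) \<longleftrightarrow> cyclic_on f S"
proof
  assume S: "S \<in> sccs_verts \<and> (card S > 1 \<or> (\<exists>u. S = {u} \<and> f u = u))"
  then obtain u where u: "S = scc_of u" by (auto simp: sccs_verts_conv_scc_of)
  have "u \<in> S" using u by (simp add: in_scc_of_self verts_UNIV)
  have "u \<in> orbit f u"
  proof (cases "card S > 1")
    case True
    then have "S \<noteq> {u}" by auto
    then obtain v where "v \<in> S" "v \<noteq> u" using \<open>u \<in> S\<close> by blast
    then have "v \<in> orbit f u" "u \<in> orbit f v"
      unfolding u scc_of_def reachable_iff_orbit by auto
    then show ?thesis by (rule orbit_trans[rotated])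
  next
    case False
    with S \<open>u \<in> S\<close> have "f u = u" by auto
    then show ?thesis by (metis orbit.base)
  qed
  then show "cyclic_on f S"
    using \<open>u \<in> S\<close> scc_of_periodic[of u] u by (auto simp: cyclic_on_def)
next
  assume S: "cyclic_on f S"
  then obtain u where u: "u \<in> S" "S = orbit f u" by (auto simp: cyclic_on_def)
  then have "S \<in> sccs_verts" using scc_of_periodic[of u]
    by (auto simp: sccs_verts_conv_scc_of verts_UNIV)
  moreover have "card S > 1 \<or> (\<exists>u. S = {u} \<and> f u = u)"
  proof (cases "card S = 1")
    case True
    then show ?thesis using u by (metis card_1_singletonE orbit_eq_singleton_iff singletonD)
  next
    case False
    moreover have "card S \<noteq> 0" using u finite_cyclic_on[OF S] by auto
    ultimately show ?thesis by linarith
  qed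
  ultimately show "S \<in> sccs_verts \<and> (card S > 1 \<or> (\<exists>u. S = {u} \<and> f u = u))" ..
qed

lemma unique_cyclic_scc_iff:
  "(\<exists>!C. C \<in> sccs \<and> (card (verts C) > 1 \<or> (\<exists>u. verts C = {u} \<and> f u = u)))
    \<longleftrightarrow> (\<exists>!S. cyclic_on f S)"
proof -
  have transfer: "(\<exists>!C. C \<in> sccs \<and> Q (verts C)) \<longleftrightarrow> (\<exists>!S. S \<in> sccs_verts \<and> Q S)" for Q
  proof
    assume "\<exists>!C. C \<in> sccs \<and> Q (verts C)"
    then show "\<exists>!S. S \<in> sccs_verts \<and> Q S" unfolding sccs_verts_conv by blast
  next
    assume unique: "\<exists>!S. S \<in> sccs_verts \<and> Q S"
    then obtain C where C: "C \<in> sccs" "Q (verts C)" unfolding sccs_verts_conv by blast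
    show "\<exists>!C. C \<in> sccs \<and> Q (verts C)"
    proof (intro ex1I[of _ C] conjI C)
      fix D
      assume D: "D \<in> sccs \<and> Q (verts D)"
      then have "verts D = verts C" using unique C unfolding sccs_verts_conv by blast
      then show "D = C" using inj_onD[OF inj_on_verts_sccs] C(1) D by blast
    qed
  qed
  from transfer[of "\<lambda>S. card S > 1 \<or> (\<exists>u. S = {u} \<and> f u = u)"]
  show ?thesis by (simp only: cyclic_scc_iff)
qed

end

section \<open>Cycles as lists\<close>

text \<open>The equation with \<open>rotate1\<close> says that \<open>f\<close> maps each entry to the cyclically next one. In this
  form, applying \<open>f\<close> entrywise and rotating the list are the same operation.\<close>

definition cycle_list :: "('v \<Rightarrow> 'v) \<Rightarrow> 'v list \<Rightarrow> bool" where
  "cycle_list f p \<longleftrightarrow> p \<noteq> [] \<and> distinct p \<and> map f p = rotate1 p"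

lemma cycle_list_rotate:
  assumes "cycle_list f p"
  shows "map (f ^^ m) p = rotate m p" and "cycle_list f (rotate m p)"
proof -
  have step: "map f (rotate m p) = rotate1 (rotate m p)" for m
    using assms by (simp add: cycle_list_def rotate_map[symmetric] rotate1_rotate_swap)
  show "cycle_list f (rotate m p)" using assms step by (simp add: cycle_list_def)
  show "map (f ^^ m) p = rotate m p"
  proof (induction m)
    case (Suc m)
    have "map (f ^^ Suc m) p = map f (map (f ^^ m) p)" by simp
    then show ?case by (simp only: Suc step rotate_Suc)
  qed simp
qed

lemma cycle_list_nth:
  assumes "cycle_list f p"
  shows "p ! (m mod length p) = (f ^^ m) (hd p)"
proof -
  have "p \<noteq> []" using assms by (simp add: cycle_list_def)
  then have "p ! (m mod length p) = hd (rotate m p)" by (simp add: hd_rotate_conv_nth)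
  also have "\<dots> = (f ^^ m) (hd p)"
    using \<open>p \<noteq> []\<close> by (simp add: cycle_list_rotate(1)[OF assms, symmetric] hd_map)
  finally show ?thesis .
qed

lemma cyclic_on_set_cycle_list:
  assumes p: "cycle_list f p"
  shows "cyclic_on f (set p)"
proof (rule cyclic_on_singleI)
  have "p \<noteq> []" using p by (simp add: cycle_list_def)
  then show "hd p \<in> set p" by simp
  show "set p = orbit f (hd p)"
  proof (intro set_eqI iffI)
    fix v
    assume "v \<in> set p"
    then obtain k where k: "k < length p" "v = p ! k" by (auto simp: in_set_conv_nth)
    then have "v = (f ^^ (k + length p)) (hd p)"
      using cycle_list_nth[OF p, of "k + length p"] by simp
    then show "v \<in> orbit f (hd p)" using k by (auto simp: orbit_altdef)
  next
    fix v
    assume "v \<in> orbit f (hd p)"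
    then obtain n where "v = (f ^^ n) (hd p)" by (auto simp: orbit_altdef)
    then show "v \<in> set p" using \<open>p \<noteq> []\<close> by (simp add: cycle_list_nth[OF p, symmetric])
  qed
qed

text \<open>The iterates of a periodic point, up to its least period, which is
  \<open>funpow_dist1 f a a\<close>.\<close>

lemma ex_cycle_list:
  assumes "cyclic_on f S"
  obtains p where "cycle_list f p" "set p = S"
proof -
  obtain a where a: "a \<in> orbit f a" "S = orbit f a" using assms by (auto simp: cyclic_on_def)
  let ?n = "funpow_dist1 f a a" and ?p = "map (\<lambda>k. (f ^^ k) a) [0..<funpow_dist1 f a a]"
  have "(f ^^ (Suc k)) a = rotate1 ?p ! k" if "k < ?n" for k
  proof (cases "Suc k = ?n")
    case True
    then show ?thesis using that funpow_dist1_prop[OF a(1)]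
      by (simp add: nth_rotate1 del: upt_Suc funpow.simps)
  next
    case False
    then show ?thesis using that by (simp add: nth_rotate1 del: upt_Suc)
  qed
  then have "map f ?p = rotate1 ?p" by (intro nth_equalityI) (simp_all del: upt_Suc)
  moreover have "distinct ?p"
    using inj_on_funpow_dist1[OF a(1)] by (simp add: distinct_map del: upt_Suc)
  ultimately have "cycle_list f ?p" by (simp add: cycle_list_def)
  moreover have "set ?p = S" using orbit_conv_funpow_dist1[OF a(1)] a(2) by (simp del: upt_Suc)
  ultimately show thesis by (rule that)
qed

text \<open>Rotate \<open>p\<close> until it starts like \<open>q\<close>; from then on both lists follow \<open>f\<close>.\<close>

lemma cycle_list_eq_rotate:
  assumes p: "cycle_list f p" and q: "cycle_list f q" and eq: "set p = set q"
  obtains m where "q = rotate m p"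
proof -
  have ne: "p \<noteq> []" "q \<noteq> []" using p q by (auto simp: cycle_list_def)
  have len: "length q = length p"
    using p q eq by (metis cycle_list_def distinct_card)
  have "hd q \<in> set p" using ne eq by simp
  then obtain m where m: "m < length p" "p ! m = hd q" by (auto simp: in_set_conv_nth)
  let ?r = "rotate m p"
  have r: "cycle_list f ?r" using cycle_list_rotate(2)[OF p] .
  have hd: "hd ?r = hd q" using m ne by (simp add: hd_rotate_conv_nth)
  have "q ! k = ?r ! k" if "k < length q" for k
    using cycle_list_nth[OF q, of k] cycle_list_nth[OF r, of k] that hd len by simp
  then have "q = ?r" using len by (intro nth_equalityI) auto
  then show thesis by (rule that)
qed

lemma unique_cycle_list_iff:
  "(\<exists>p. cycle_list f p \<and> (\<forall>q. cycle_list f q \<longrightarrow> (\<exists>m. q = rotate m p)))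
    \<longleftrightarrow> (\<exists>!S. cyclic_on f S)"
proof
  assume "\<exists>p. cycle_list f p \<and> (\<forall>q. cycle_list f q \<longrightarrow> (\<exists>m. q = rotate m p))"
  then obtain p where p: "cycle_list f p" "\<And>q. cycle_list f q \<Longrightarrow> \<exists>m. q = rotate m p" by blast
  show "\<exists>!S. cyclic_on f S"
  proof (rule ex1I[of _ "set p"])
    show "cyclic_on f (set p)" by (rule cyclic_on_set_cycle_list[OF p(1)])
    show "S = set p" if S: "cyclic_on f S" for S
      using ex_cycle_list[OF S] p(2) by (metis set_rotate)
  qed
next
  assume "\<exists>!S. cyclic_on f S"
  then obtain S where S: "cyclic_on f S" "\<And>T. cyclic_on f T \<Longrightarrow> T = S" by blast
  obtain p where p: "cycle_list f p" "set p = S" using ex_cycle_list[OF S(1)] .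
  have "\<exists>m. q = rotate m p" if q: "cycle_list f q" for q
    using cycle_list_eq_rotate[OF p(1) q] S(2)[OF cyclic_on_set_cycle_list[OF q]] p(2) by metis
  then show "\<exists>p. cycle_list f p \<and> (\<forall>q. cycle_list f q \<longrightarrow> (\<exists>m. q = rotate m p))"
    using p(1) by blast
qed

lemma majority_cycle_iff_cycle_list:
  assumes maj: "\<And>i j. W $ i $ j > 1 / 2 \<longleftrightarrow> j = f i"
  shows "majority_cycle W p \<longleftrightarrow> cycle_list f p"
proof (cases p)
  case Nil
  then show ?thesis by (simp add: majority_cycle_def cycle_list_def)
next
  case (Cons a r)
  have len: "length p = Suc (length r)" and rot: "rotate1 p = r @ [a]" by (simp_all add: Cons)
  have last: "last p = p ! length r" by (simp add: Cons last_conv_nth)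
  have "map f p = rotate1 p \<longleftrightarrow> (\<forall>k<Suc (length r). f (p ! k) = (r @ [a]) ! k)"
    unfolding rot by (subst list_eq_iff_nth_eq) (simp add: len)
  also have "\<dots> \<longleftrightarrow> (\<forall>k<length r. f (p ! k) = r ! k) \<and> f (last p) = a"
    by (auto simp: last nth_append less_Suc_eq)
  finally have rotate: "map f p = rotate1 p \<longleftrightarrow>
      (\<forall>k<length r. f (p ! k) = r ! k) \<and> f (last p) = a" .
  have tail: "p ! Suc k = r ! k" for k by (simp add: Cons)
  have "majority_cycle W p \<longleftrightarrow>
      distinct p \<and> (\<forall>k<length r. r ! k = f (p ! k)) \<and> a = f (last p)"
    unfolding majority_cycle_def maj len tail by (simp add: Cons)
  also have "\<dots> \<longleftrightarrow> cycle_list f p"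
    unfolding cycle_list_def rotate by (auto simp: Cons)
  finally show ?thesis .
qed

section \<open>Consensus in the best-response dynamics\<close>

lemma functional_digraph_F_matrix:
  assumes "0 < \<beta>" "\<beta> < 1"
  shows "functional_digraph (matrix_digraph (F_matrix \<beta> W)) (dominant W)"
proof -
  have "wf_digraph (matrix_digraph (F_matrix \<beta> W))"
    by unfold_locales (simp_all add: matrix_digraph_def)
  moreover have "F_matrix \<beta> W $ u $ v > 0 \<longleftrightarrow> v = u \<or> v = dominant W u" for u v
    using assms by (auto simp: F_matrix_nth)
  ultimately show ?thesis
    by (auto simp: functional_digraph_def functional_digraph_axioms_def matrix_digraph_def
        arcs_ends_conv image_iff)
qed

theorem mainTheorem5:
  fixes W :: "real ^ 'n ^ 'n" and \<alpha> \<beta> :: real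
  assumes "row_stochastic W"
    and "0 < \<beta>" "\<beta> < 1"
    and "0 < \<alpha>" "\<alpha> < 1"
    and "\<forall>i. \<exists>j. W $ i $ j > 1 / 2"
  shows "row_stochastic (F_matrix \<beta> W) \<and>
    (\<forall>x. br_step \<alpha> \<beta> W x = F_matrix \<beta> W *v x) \<and>
    ((\<forall>x0. achieves_consensus (\<lambda>x. F_matrix \<beta> W *v x) x0) \<longleftrightarrow>
       (\<exists>!C. C \<in> pre_digraph.sccs (matrix_digraph (F_matrix \<beta> W)) \<and> cyclic_component W C)) \<and>
    ((\<exists>!C. C \<in> pre_digraph.sccs (matrix_digraph (F_matrix \<beta> W)) \<and> cyclic_component W C) \<longleftrightarrow>
       unique_majority_cycle W) \<and>
    ((\<forall>i. W $ i $ i \<le> 1 / 2) \<longrightarrow>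
       ((\<forall>x0. achieves_consensus (\<lambda>x. F_matrix \<beta> W *v x) x0) \<longleftrightarrow>
         (\<exists>!C. C \<in> pre_digraph.sccs (matrix_digraph (F_matrix \<beta> W)) \<and> card (verts C) > 1)))"
proof -
  let ?f = "dominant W" and ?sccs = "pre_digraph.sccs (matrix_digraph (F_matrix \<beta> W))"
  have maj: "W $ i $ j > 1 / 2 \<longleftrightarrow> j = ?f i" for i j
    using majority_iff_dominant assms(1,6) by blast
  have response: "br_step \<alpha> \<beta> W x = F_matrix \<beta> W *v x" for x
    using best_response_majority[OF assms(1,4) less_imp_le[OF assms(5)]] maj
    by (simp add: br_step_def F_matrix_mult lazy_step_def vec_eq_iff)
  have component: "cyclic_component W C \<longleftrightarrow>
      card (verts C) > 1 \<or> (\<exists>u. verts C = {u} \<and> ?f u = u)" for C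
    unfolding cyclic_component_def maj by metis
  interpret functional_digraph "matrix_digraph (F_matrix \<beta> W)" ?f
    using assms(2,3) by (rule functional_digraph_F_matrix)
  have consensus: "(\<forall>x0. achieves_consensus (\<lambda>x. F_matrix \<beta> W *v x) x0)
      \<longleftrightarrow> (\<exists>!S. cyclic_on ?f S)"
    using consensus_iff_unique_cycle[OF assms(2,3)] by (simp add: F_matrix_mult)
  have components: "(\<exists>!C. C \<in> ?sccs \<and> cyclic_component W C) \<longleftrightarrow> (\<exists>!S. cyclic_on ?f S)"
    unfolding component by (rule unique_cyclic_scc_iff)
  have cycles: "unique_majority_cycle W \<longleftrightarrow> (\<exists>!S. cyclic_on ?f S)"
    by (simp add: unique_majority_cycle_def majority_cycle_iff_cycle_list[OF maj]
        unique_cycle_list_iff)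
  have "cyclic_component W C \<longleftrightarrow> card (verts C) > 1" if "\<forall>i. W $ i $ i \<le> 1 / 2" for C
    using that by (auto simp: cyclic_component_def not_less[symmetric])
  with components have large_components:
    "(\<exists>!C. C \<in> ?sccs \<and> card (verts C) > 1) \<longleftrightarrow> (\<exists>!S. cyclic_on ?f S)"
    if "\<forall>i. W $ i $ i \<le> 1 / 2"
    using that by simp
  have "row_stochastic (F_matrix \<beta> W)" using assms(2,3) by (intro row_stochastic_F_matrix) simp_all
  then show ?thesis
    unfolding consensus components cycles using response large_components by blast
qed

end
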